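(* Let $\mathcal{O}$ be the local ring of an algebroid curve $Q=\bigcap_{i\in I}P_i$, and let $G$ be a fixed Standard Basis for $\mathcal{O}$. Then every (regular, finitely generated) fractional ideal $\mathcal{I}$ of $\mathcal{O}$ admits a Standard Basis, i.e. there is a finite subset $H\subset\mathcal{I}\setminus\{0\}$ such that every nonzero element of $\mathcal{I}$ admits a reduction modulo $(H,G)$.
   Context: Setting. $\mathbb{K}$ is an algebraically closed field. $(\mathcal{O},\mathcal{M},\mathbb{K})$ is a one-dimensional complete Noetherian local ring with coefficient field $\mathbb{K}$, $\mathcal{O}=\mathbb{K}[[X_1,\ldots,X_n]]/Q$ with $Q$ a proper radical ideal and $n=\dim_{\mathbb{K}}\mathcal{M}/\mathcal{M}^2$; one calls $Q$ an algebroid curve and $\mathcal{O}$ its local ring. Write $Q=\bigcap_{i\in I}P_i$, $I=\{1,\ldots,r\}$, with $P_i$ the distinct minimal primes over $Q$ (branches), each with $\mathcal{O}_i=\mathbb{K}[[X_1,\ldots,X_n]]/P_i$ of dimension one. The integral closure of $\mathcal{O}_i$ in its fraction field $\mathcal{Q}_i$ is a discrete valuation ring $\overline{\mathcal{O}_i}=\mathbb{K}[[t_i]]$. The total ring of fractions of $\mathcal{O}$ is $\mathcal{Q}=\bigoplus_{i\in I}\mathcal{Q}_i=\bigoplus_{i\in I}\mathbb{K}((t_i))$, and $\mathcal{O}\hookrightarrow\mathcal{Q}$ by $g\mapsto(g_1,\ldots,g_r)$, $g_i$ the image of $g$ in $\mathcal{O}_i$. For $h=(h_1,\ldots,h_r)\in\mathcal{Q}$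 put $v_i(h)=\operatorname{ord}_{t_i}(h_i)\in\mathbb{Z}\cup\{\infty\}$ ($v_i(h)=\infty$ if $h_i=0$) and $v(h)=(v_1(h),\ldots,v_r(h))$. A fractional ideal of $\mathcal{O}$ means a finitely generated $\mathcal{O}$-submodule of $\mathcal{Q}$ containing a non zero divisor of $\mathcal{Q}$. Reductions. Let $G\subset\mathcal{M}\setminus\{0\}$ be finite and $H\subset\mathcal{Q}\setminus\{0\}$. A $G$-product is an element $G^{\alpha}=\prod_{g_i\in G}g_i^{\alpha_i}$ with $\alpha_i\in\mathbb{N}=\{0,1,2,\ldots\}$. For nonzero $f\in\mathcal{Q}$ and $k\in I_f:=\{i\in I: v_i(f)\neq\infty\}$, an element $f'$ is a $k$-reduction of $f$ modulo $(H,G)$ if there are $c\in\mathbb{K}$, $h\in H$ and a $G$-product $G^\alpha$ with $f'=f-cG^\alpha h$, $v_i(f')\ge v_i(f)$ for all $i\in I$ and $v_k(f')>v_k(f)$. A reduction of $f$ modulo $(H,G)$ is a $k$-reduction for some $k\in I_f$. A Standard Basis for $\mathcal{O}$ is a finite set $G\subset\mathcal{M}\setminus\{0\}$ such that every nonzero element of $\mathcal{O}$ admits a reduction modulo $(\{1\},G)$; it is known that such $G$ exists. With $G$ fixed, a Standard Basis for a fractional ideal $\mathcal{I}$ is a finite set $H\subset\mathcal{I}\setminus\{0\}$ such that every nonzero element of $\mathcal{I}$ admits a reduction modulo $(H,G)$. *)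

theory Defs
  imports
    "HOL-Algebra.Algebra"
    "HOL-Algebra.Algebraic_Closure_Type"
    "HOL-Computational_Algebra.Formal_Laurent_Series"
    "HOL-Library.Function_Algebras"
    "HOL-Library.Extended"
    "HOL-Library.Extended_Nat"
begin

section \<open>Formal power series in finitely many variables\<close>

text \<open>The type \<open>('n, 'k) mfps\<close> is the ring $K[[X_1, \ldots, X_n]]$ where the variables are indexed
  by the finite type \<open>'n\<close>; a series is the family of its coefficients, indexed by exponent vectors.\<close>

typedef ('n, 'k) mfps = "UNIV :: (('n \<Rightarrow> nat) \<Rightarrow> 'k) set"
  morphisms mfps_nth Abs_mfps
  by simp

setup_lifting type_definition_mfps

lemma mfps_eqI: "(\<And>m. mfps_nth f m = mfps_nth g m) \<Longrightarrow> f = g"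
  by transfer auto

lemma finite_atMost_exponent: "finite {..m :: 'n::finite \<Rightarrow> nat}"
proof -
  have "{..m} \<subseteq> PiE UNIV (\<lambda>i. {..m i})"
    by (auto simp: le_fun_def)
  then show ?thesis
    by (rule finite_subset) (auto intro: finite_PiE)
qed

instantiation mfps :: (finite, comm_ring_1) comm_ring_1
begin

lift_definition zero_mfps :: "('a, 'b) mfps" is "\<lambda>_. 0" .

lift_definition one_mfps :: "('a, 'b) mfps" is "\<lambda>m. if m = 0 then 1 else 0" .

lift_definition plus_mfps :: "('a, 'b) mfps \<Rightarrow> ('a, 'b) mfps \<Rightarrow> ('a, 'b) mfps"
  is "\<lambda>f g m. f m + g m" .

lift_definition minus_mfps :: "('a, 'b) mfps \<Rightarrow> ('a, 'b) mfps \<Rightarrow> ('a, 'b) mfps"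
  is "\<lambda>f g m. f m - g m" .

lift_definition uminus_mfps :: "('a, 'b) mfps \<Rightarrow> ('a, 'b) mfps"
  is "\<lambda>f m. - f m" .

lift_definition times_mfps :: "('a, 'b) mfps \<Rightarrow> ('a, 'b) mfps \<Rightarrow> ('a, 'b) mfps"
  is "\<lambda>f g m. \<Sum>a\<le>m. f a * g (m - a)" .

instance
proof
  fix f g h :: "('a, 'b) mfps"
  show "f + g + h = f + (g + h)" "f + g = g + f" "0 + f = f" "- f + f = 0" "f - g = f + - g"
    by (transfer; simp add: add_ac)+
  show "f * g = g * f"
  proof (transfer, rule ext)
    fix f g :: "('a \<Rightarrow> nat) \<Rightarrow> 'b" and m
    show "(\<Sum>a\<le>m. f a * g (m - a)) = (\<Sum>a\<le>m. g a * f (m - a))"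
    proof (rule sum.reindex_bij_witness[of _ "\<lambda>a. m - a" "\<lambda>a. m - a"])
      fix a assume "a \<in> {..m}"
      then have e: "m - (m - a) = a"
        by (auto simp: le_fun_def fun_eq_iff)
      then show "m - (m - a) = a" .
      show "m - a \<in> {..m}"
        by (auto simp: le_fun_def)
      show "g (m - a) * f (m - (m - a)) = f a * g (m - a)"
        by (simp only: e mult.commute)
    qed (auto simp: le_fun_def fun_eq_iff)
  qed
  show "f * g * h = f * (g * h)"
  proof (transfer, rule ext)
    fix f g h :: "('a \<Rightarrow> nat) \<Rightarrow> 'b" and m
    have "(\<Sum>a\<le>m. (\<Sum>b\<le>a. f b * g (a - b)) * h (m - a))
        = (\<Sum>(a, b)\<in>Sigma {..m} (\<lambda>a. {..a}). f b * g (a - b) * h (m - a))"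
      by (simp add: sum_distrib_right sum.Sigma finite_atMost_exponent)
    also have "\<dots> = (\<Sum>(b, c)\<in>Sigma {..m} (\<lambda>b. {..m - b}). f b * (g c * h (m - b - c)))"
    proof (rule sum.reindex_bij_witness[of _ "\<lambda>(b, c). (b + c, b)" "\<lambda>(a, b). (b, a - b)"])
      fix x assume x: "x \<in> Sigma {..m} (\<lambda>a. {..a})"
      obtain a b where ab: "x = (a, b)" by (cases x)
      have le: "a \<le> m" "b \<le> a" using x ab by auto
      have e: "m - b - (a - b) = m - a"
        using le by (force simp: le_fun_def fun_eq_iff)
      show "(case case x of (a, b) \<Rightarrow> (b, a - b) of (b, c) \<Rightarrow> (b + c, b)) = x"
        using le ab by (auto simp: le_fun_def fun_eq_iff)
      have "b i \<le> m i" "a i - b i \<le> m i - b i" for i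
        using le unfolding le_fun_def by (meson order_trans diff_le_mono)+
      then show "(case x of (a, b) \<Rightarrow> (b, a - b)) \<in> Sigma {..m} (\<lambda>b. {..m - b})"
        using ab by (auto simp: le_fun_def)
      show "(case case x of (a, b) \<Rightarrow> (b, a - b) of (b, c) \<Rightarrow> f b * (g c * h (m - b - c)))
          = (case x of (a, b) \<Rightarrow> f b * g (a - b) * h (m - a))"
        using ab e by (simp add: mult.assoc)
    next
      fix x assume x: "x \<in> Sigma {..m} (\<lambda>b. {..m - b})"
      obtain b c where bc: "x = (b, c)" by (cases x)
      have le: "b i \<le> m i" "c i \<le> m i - b i" for i
        using x bc by (auto simp: le_fun_def)
      show "(case case x of (b, c) \<Rightarrow> (b + c, b) of (a, b) \<Rightarrow> (b, a - b)) = x"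
        using bc by (auto simp: fun_eq_iff)
      have "b i + c i \<le> m i" for i
        using le[of i] by linarith
      then show "(case x of (b, c) \<Rightarrow> (b + c, b)) \<in> Sigma {..m} (\<lambda>a. {..a})"
        using bc by (auto simp: le_fun_def)
    qed
    also have "\<dots> = (\<Sum>b\<le>m. f b * (\<Sum>c\<le>m - b. g c * h (m - b - c)))"
      by (simp add: sum_distrib_left sum.Sigma finite_atMost_exponent)
    finally show "(\<Sum>a\<le>m. (\<Sum>b\<le>a. f b * g (a - b)) * h (m - a))
      = (\<Sum>b\<le>m. f b * (\<Sum>c\<le>m - b. g c * h (m - b - c)))" .
  qed
  show "1 * f = f"
  proof (transfer, rule ext)
    fix f :: "('a \<Rightarrow> nat) \<Rightarrow> 'b" and m
    have "(\<Sum>a\<le>m. (if a = 0 then 1 else 0) * f (m - a)) = (\<Sum>a\<in>{0}. f (m - a))"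
      by (rule sum.mono_neutral_cong_right)
         (auto simp: finite_atMost_exponent le_fun_def zero_fun_def)
    also have "m - 0 = m"
      by (simp add: fun_eq_iff)
    then have "(\<Sum>a\<in>{0}. f (m - a)) = f m"
      by simp
    finally show "(\<Sum>a\<le>m. (if a = 0 then 1 else 0) * f (m - a)) = f m" .
  qed
  show "(f + g) * h = f * h + g * h"
    by transfer (simp add: distrib_right sum.distrib)
  show "(0 :: ('a, 'b) mfps) \<noteq> 1"
    by transfer (auto simp: fun_eq_iff)
qed

end

lift_definition mfps_const :: "'k::zero \<Rightarrow> ('n, 'k) mfps"
  is "\<lambda>c m. if m = (\<lambda>_. 0) then c else 0" .

abbreviation series_ring :: "('n::finite, 'k::comm_ring_1) mfps ring"
  where "series_ring \<equiv> ring_of_type_algebra"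


section \<open>Notions from commutative algebra\<close>

definition radical_ideal :: "'a set \<Rightarrow> ('a, 'b) ring_scheme \<Rightarrow> bool" where
  "radical_ideal J A \<longleftrightarrow>
     ideal J A \<and> (\<forall>x\<in>carrier A. \<forall>m::nat. x [^]\<^bsub>A\<^esub> m \<in> J \<longrightarrow> x \<in> J)"

definition minimal_primes :: "('a, 'b) ring_scheme \<Rightarrow> 'a set \<Rightarrow> 'a set set" where
  "minimal_primes A J =
     {P. primeideal P A \<and> J \<subseteq> P \<and> (\<forall>P'. primeideal P' A \<and> J \<subseteq> P' \<and> P' \<subseteq> P \<longrightarrow> P' = P)}"

definition krull_dim :: "('a, 'b) ring_scheme \<Rightarrow> enat" where
  "krull_dim A = Sup {enat n |n. \<exists>p :: nat \<Rightarrow> 'a set.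
     (\<forall>i\<le>n. primeideal (p i) A) \<and> (\<forall>i<n. p i \<subset> p (Suc i))}"

definition local_ring :: "('a, 'b) ring_scheme \<Rightarrow> 'a set \<Rightarrow> bool" where
  "local_ring A M \<longleftrightarrow> cring A \<and> maximalideal M A \<and> (\<forall>M'. maximalideal M' A \<longrightarrow> M' = M)"

definition integral_over :: "'a::comm_ring_1 set \<Rightarrow> 'a \<Rightarrow> bool" where
  "integral_over S x \<longleftrightarrow>
     (\<exists>p :: 'a poly. Polynomial.lead_coeff p = 1 \<and> (\<forall>i. Polynomial.coeff p i \<in> S) \<and> poly p x = 0)"


section \<open>Algebroid curves and their branches\<close>

abbreviation curve_ring :: "('n::finite, 'k::comm_ring_1) mfps set \<Rightarrow> ('n, 'k) mfps set ring"
  where "curve_ring Q \<equiv> series_ring Quot Q"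

definition scalar :: "('n::finite, 'k::comm_ring_1) mfps set \<Rightarrow> 'k \<Rightarrow> ('n, 'k) mfps set" where
  "scalar Q c = Q +>\<^bsub>series_ring\<^esub> mfps_const c"

text \<open>The $K$-vector space $M/M^2$ is realised as the image of \<open>M\<close> in the $K$-algebra $O/M^2$, so
  that the library notion of dimension (of a subspace of a ring over a subfield) applies.\<close>

definition has_embedding_dim :: "('n::finite, 'k::comm_ring_1) mfps set \<Rightarrow> ('n, 'k) mfps set set \<Rightarrow> nat \<Rightarrow> bool"
  where "has_embedding_dim Q M d \<longleftrightarrow>
    (let A = curve_ring Q; M2 = ideal_prod A M M; proj = (\<lambda>x. M2 +>\<^bsub>A\<^esub> x)
     in ring.dimension (A Quot M2) d (proj ` range (scalar Q)) (proj ` M))"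

definition algebroid_curve :: "('n::finite, 'k::alg_closed_field) mfps set \<Rightarrow> ('n, 'k) mfps set set \<Rightarrow> bool"
  where "algebroid_curve Q M \<longleftrightarrow>
    radical_ideal Q series_ring \<and> Q \<noteq> carrier series_ring \<and>
    local_ring (curve_ring Q) M \<and>
    krull_dim (curve_ring Q) = 1 \<and>
    has_embedding_dim Q M (card (UNIV :: 'n set))"

definition branches :: "('n::finite, 'k::alg_closed_field) mfps set \<Rightarrow> ('r \<Rightarrow> ('n, 'k) mfps set) \<Rightarrow> bool"
  where "branches Q P \<longleftrightarrow>
    inj P \<and> range P = minimal_primes series_ring Q \<and> Q = (\<Inter>i. P i) \<and>
    (\<forall>i. krull_dim (curve_ring (P i)) = 1)"

text \<open>\<open>branch_normalization P \<phi>\<close> says that the homomorphism \<open>\<phi>\<close> of $K$-algebras makes $K((t))$ the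
  fraction field of the domain $K[[X_1, \ldots, X_n]]/P$ in such a way that the integral closure of
  this domain in its fraction field is $K[[t]]$.\<close>

definition branch_normalization ::
    "('n::finite, 'k::alg_closed_field) mfps set \<Rightarrow> (('n, 'k) mfps set \<Rightarrow> 'k fls) \<Rightarrow> bool"
  where "branch_normalization P \<phi> \<longleftrightarrow>
    \<phi> \<in> ring_hom (curve_ring P) ring_of_type_algebra \<and>
    inj_on \<phi> (carrier (curve_ring P)) \<and>
    (\<forall>c. \<phi> (scalar P c) = fls_const c) \<and>
    (\<forall>z. \<exists>a\<in>carrier (curve_ring P). \<exists>b\<in>carrier (curve_ring P). \<phi> b \<noteq> 0 \<and> z = \<phi> a / \<phi> b) \<and>
    {z. integral_over (\<phi> ` carrier (curve_ring P)) z} = range fps_to_fls"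

text \<open>The total ring of fractions of the curve with branches \<open>P i\<close> is the product ring
  \<open>'r \<Rightarrow> 'k fls\<close>. If \<open>x\<close> is a coset of \<open>Q\<close>, then \<open>P i <+> x\<close> is the image of \<open>x\<close> in the ring of
  the branch \<open>P i\<close>.\<close>

definition to_total ::
    "('r \<Rightarrow> ('n::finite, 'k::alg_closed_field) mfps set) \<Rightarrow> ('r \<Rightarrow> ('n, 'k) mfps set \<Rightarrow> 'k fls)
      \<Rightarrow> ('n, 'k) mfps set \<Rightarrow> 'r \<Rightarrow> 'k fls"
  where "to_total P \<phi> x = (\<lambda>i. \<phi> i (P i <+>\<^bsub>series_ring\<^esub> x))"

definition val :: "'r \<Rightarrow> ('r \<Rightarrow> 'k::zero fls) \<Rightarrow> int extended" where
  "val i h = (if h i = 0 then \<infinity> else Fin (fls_subdegree (h i)))"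


section \<open>Fractional ideals\<close>

definition overring_module :: "('a \<Rightarrow> 'q::comm_ring_1) \<Rightarrow> ('a, 'q) module" where
  "overring_module \<iota> =
     \<lparr>carrier = UNIV, monoid.mult = (*), one = 1, ring.zero = 0, add = (+), module.smult = (\<lambda>a x. \<iota> a * x)\<rparr>"

definition fractional_ideal :: "('a, 'b) ring_scheme \<Rightarrow> ('a \<Rightarrow> 'q::comm_ring_1) \<Rightarrow> 'q set \<Rightarrow> bool" where
  "fractional_ideal A \<iota> I \<longleftrightarrow>
     submodule I A (overring_module \<iota>) \<and>
     (\<exists>S. finite S \<and> I = {\<Sum>s\<in>S. \<iota> (a s) * s |a. a \<in> S \<rightarrow> carrier A}) \<and>
     (\<exists>x\<in>I. \<forall>y. x * y = 0 \<longrightarrow> y = 0)"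


section \<open>Reductions and Standard Bases\<close>

definition is_product_of :: "'q::comm_ring_1 set \<Rightarrow> 'q \<Rightarrow> bool" where
  "is_product_of G x \<longleftrightarrow> (\<exists>\<alpha> :: 'q \<Rightarrow> nat. x = (\<Prod>g\<in>G. g ^ \<alpha> g))"

definition k_reduction ::
    "('r \<Rightarrow> 'k::alg_closed_field fls) set \<Rightarrow> ('r \<Rightarrow> 'k fls) set \<Rightarrow> 'r \<Rightarrow> ('r \<Rightarrow> 'k fls) \<Rightarrow> ('r \<Rightarrow> 'k fls) \<Rightarrow> bool"
  where "k_reduction H G k f f' \<longleftrightarrow>
    val k f \<noteq> \<infinity> \<and>
    (\<exists>c. \<exists>h\<in>H. \<exists>x. is_product_of G x \<and> f' = f - (\<lambda>_. fls_const c) * x * h) \<and>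
    (\<forall>i. val i f' \<ge> val i f) \<and> val k f' > val k f"

definition admits_reduction ::
    "('r \<Rightarrow> 'k::alg_closed_field fls) set \<Rightarrow> ('r \<Rightarrow> 'k fls) set \<Rightarrow> ('r \<Rightarrow> 'k fls) \<Rightarrow> bool"
  where "admits_reduction H G f \<longleftrightarrow> (\<exists>k f'. k_reduction H G k f f')"

definition standard_basis_ring ::
    "('a, 'b) ring_scheme \<Rightarrow> 'a set \<Rightarrow> ('a \<Rightarrow> 'r \<Rightarrow> 'k::alg_closed_field fls) \<Rightarrow> 'a set \<Rightarrow> bool"
  where "standard_basis_ring A M \<iota> G \<longleftrightarrow>
    finite G \<and> G \<subseteq> M - {\<zero>\<^bsub>A\<^esub>} \<and>
    (\<forall>f\<in>carrier A - {\<zero>\<^bsub>A\<^esub>}. admits_reduction {1} (\<iota> ` G) (\<iota> f))"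

text \<open>Here \<open>G\<close> is already regarded as a subset of the total ring of fractions.\<close>

definition standard_basis_ideal ::
    "('r \<Rightarrow> 'k::alg_closed_field fls) set \<Rightarrow> ('r \<Rightarrow> 'k fls) set \<Rightarrow> ('r \<Rightarrow> 'k fls) set \<Rightarrow> bool"
  where "standard_basis_ideal G I H \<longleftrightarrow>
    finite H \<and> H \<subseteq> I - {0} \<and> (\<forall>f\<in>I - {0}. admits_reduction H G f)"

end

theory Submission
  imports Defs
begin

text \<open>
  For every branch \<open>k\<close> some \<open>f \<in> \<O>\<close> vanishes on all other branches and has finite positive value
  on \<open>k\<close>; as \<open>f\<close> admits a reduction, some \<open>G\<close>-product \<open>x\<^sub>k\<close> has the same values as \<open>f\<close>.
  Multiplication by \<open>x\<^sub>k\<close> translates the set \<open>W\<^sub>k\<close> of finite \<open>k\<close>-th values of \<open>\<I>\<close> by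
  \<open>v\<^sub>k(x\<^sub>k) > 0\<close>, and \<open>W\<^sub>k\<close> is bounded below, so it is generated under this translation by a finite
  set \<open>N\<^sub>k\<close>. If \<open>v\<^sub>k(f) \<in> W\<^sub>k - N\<^sub>k\<close> for some \<open>k\<close>, then \<open>f\<close> is reduced by \<open>x\<^sub>k\<^sup>m h\<close>, where
  \<open>m > 0\<close> and \<open>h\<close> realises an element of \<open>N\<^sub>k\<close>: the product vanishes on all other branches. The
  remaining \<open>f\<close> have only finitely many value vectors \<open>v(f)\<close>, and one \<open>h\<close> for each vector suffices.
\<close>

section \<open>Reductions in terms of values\<close>

lemma val_le_iff: "val i f \<le> val i g \<longleftrightarrow> g i = 0 \<or> (f i \<noteq> 0 \<and> fls_subdegree (f i) \<le> fls_subdegree (g i))"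
  by (simp add: val_def)

lemma val_less_iff: "val i f < val i g \<longleftrightarrow> f i \<noteq> 0 \<and> (g i = 0 \<or> fls_subdegree (f i) < fls_subdegree (g i))"
  by (simp add: val_def)

lemma val_eq_infinity_iff: "val i f = \<infinity> \<longleftrightarrow> f i = 0"
  by (simp add: val_def)

lemma exists_const_cancelling_leading_term:
  fixes u v :: "'k::field fls"
  assumes "u \<noteq> 0" "v \<noteq> 0" "fls_subdegree v = fls_subdegree u"
  obtains c where "u - fls_const c * v = 0 \<or> fls_subdegree u < fls_subdegree (u - fls_const c * v)"
proof -
  define c where "c = fls_nth u (fls_subdegree u) / fls_nth v (fls_subdegree u)"
  have v0: "fls_nth v (fls_subdegree u) \<noteq> 0"
    using assms by (metis nth_fls_subdegree_nonzero)
  have "fls_nth (u - fls_const c * v) n = 0" if "n \<le> fls_subdegree u" for n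
    using that assms(3) v0 by (cases "n = fls_subdegree u") (auto simp: c_def)
  then show thesis
    using that fls_subdegree_greaterI by blast
qed

text \<open>The constant is dictated by the leading coefficients on branch \<open>k\<close>. On the
  other branches, subtracting something of at least the same value cannot lower the value of
  \<open>f\<close>.\<close>

lemma admits_reductionI:
  fixes f h x :: "'r \<Rightarrow> 'k::alg_closed_field fls"
  assumes f: "f k \<noteq> 0" and h: "h \<in> H" and x: "is_product_of G x"
    and ge: "\<And>i. val i f \<le> val i (x * h)" and eq: "val k (x * h) = val k f"
  shows "admits_reduction H G f"
proof -
  have y: "(x * h) k \<noteq> 0" "fls_subdegree ((x * h) k) = fls_subdegree (f k)"
    using eq f by (auto simp: val_def split: if_splits)
  obtain c where c: "f k - fls_const c * (x * h) k = 0 \<or>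
      fls_subdegree (f k) < fls_subdegree (f k - fls_const c * (x * h) k)"
    using exists_const_cancelling_leading_term[OF f y] by blast
  define f' where "f' = f - (\<lambda>_. fls_const c) * x * h"
  have f'_eq: "f' i = f i - fls_const c * (x * h) i" for i
    by (simp add: f'_def mult.assoc)
  have "val i f \<le> val i f'" for i
  \<comment> \<open>Degenerate cases are split off because \<open>fls_subdegree 0 = 0\<close> does
    not express infinite order.\<close>
  proof (cases "f i = 0 \<or> f' i = 0 \<or> c = 0 \<or> (x * h) i = 0")
    case True
    with ge[of i] show ?thesis
      by (auto simp: val_le_iff f'_eq)
  next
    case False
    then have "fls_subdegree (fls_const c * (x * h) i) = fls_subdegree ((x * h) i)"
      by (subst fls_subdegree_mult) auto
    moreover have "fls_subdegree (f i) \<le> fls_subdegree ((x * h) i)"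
      using ge[of i] False by (auto simp: val_le_iff)
    ultimately have "fls_subdegree (f i) \<le> fls_subdegree (f' i)"
      using fls_subdegree_minus[of "f i" "fls_const c * (x * h) i"] False
      unfolding f'_eq by simp
    then show ?thesis
      using False by (simp add: val_le_iff)
  qed
  moreover have "val k f < val k f'"
    using c f by (auto simp: val_less_iff f'_eq)
  ultimately have "k_reduction H G k f f'"
    unfolding k_reduction_def using f h x f'_def by (auto simp: val_eq_infinity_iff)
  then show ?thesis
    unfolding admits_reduction_def by blast
qed

section \<open>Products of elements of a set\<close>

lemma is_product_of_one: "is_product_of G 1"
  unfolding is_product_of_def by (rule exI[of _ "\<lambda>_. 0"]) simp

lemma is_product_of_mult:
  assumes "is_product_of G x" "is_product_of G y"
  shows "is_product_of G (x * y)"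
proof -
  obtain \<alpha> \<beta> where "x = (\<Prod>g\<in>G. g ^ \<alpha> g)" "y = (\<Prod>g\<in>G. g ^ \<beta> g)"
    using assms unfolding is_product_of_def by blast
  then have "x * y = (\<Prod>g\<in>G. g ^ (\<alpha> g + \<beta> g))"
    by (simp add: power_add prod.distrib)
  then show ?thesis
    unfolding is_product_of_def by (rule exI[of _ "\<lambda>g. \<alpha> g + \<beta> g"])
qed

lemma is_product_of_power: "is_product_of G x \<Longrightarrow> is_product_of G (x ^ n)"
  by (induction n) (auto intro: is_product_of_one is_product_of_mult)

lemma is_product_of_mult_mem:
  assumes "is_product_of G x" "f \<in> J" and closed: "\<And>g h. g \<in> G \<Longrightarrow> h \<in> J \<Longrightarrow> g * h \<in> J"
  shows "x * f \<in> J"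
proof -
  obtain \<alpha> where x: "x = (\<Prod>g\<in>G. g ^ \<alpha> g)"
    using assms(1) unfolding is_product_of_def by blast
  have power: "g ^ n * h \<in> J" if "g \<in> G" "h \<in> J" for g h and n :: nat
    by (induction n) (auto simp: that mult.assoc closed)
  have "(\<Prod>g\<in>F. g ^ \<alpha> g) * f \<in> J" if "finite F" "F \<subseteq> G" for F
    using that by (induction F) (auto simp: assms(2) mult.assoc power)
  then show ?thesis
    using assms(2) by (cases "finite G") (auto simp: x)
qed

section \<open>A finite standard basis from products supported on one branch\<close>

text \<open>Each residue class modulo \<open>n\<close> that meets \<open>S\<close> contributes its
  least element; the rest of \<open>S\<close> in that class is reached from it by adding multiples
  of \<open>n\<close>.\<close>

lemma finite_generators_mod_int:
  fixes S :: "int set"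
  assumes bound: "\<And>w. w \<in> S \<Longrightarrow> b \<le> w" and n: "n > 0"
  obtains N where "finite N" "N \<subseteq> S" "\<And>w. w \<in> S \<Longrightarrow> \<exists>w0\<in>N. \<exists>m. w = w0 + int m * int n"
proof -
  \<comment> \<open>Offsets from \<open>b\<close> turn the search into one over the naturals. For a
    class that misses \<open>S\<close>, \<open>L r\<close> is unspecified, whence the intersection
    with \<open>S\<close> in \<open>N\<close>.\<close>
  define L where "L r = (LEAST m. b + int m \<in> S \<and> m mod n = r)" for r
  define N where "N = (\<lambda>r. b + int (L r)) ` {..<n} \<inter> S"
  have "\<exists>w0\<in>N. \<exists>m. w = w0 + int m * int n" if w: "w \<in> S" for w
  proof -
    define m where "m = nat (w - b)"
    have wm: "w = b + int m"
      using bound[OF w] by (simp add: m_def)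
    have "b + int m \<in> S \<and> m mod n = m mod n"
      using w wm by simp
    then have L: "b + int (L (m mod n)) \<in> S \<and> L (m mod n) mod n = m mod n"
        and le: "L (m mod n) \<le> m"
      unfolding L_def by (rule LeastI, rule Least_le)
    have "n dvd m - L (m mod n)"
      using L le by (metis mod_eq_dvd_iff_nat)
    then obtain q where "m - L (m mod n) = n * q" by blast
    then have "m = L (m mod n) + q * n"
      using le by (simp add: mult.commute)
    then have "w = b + int (L (m mod n)) + int q * int n"
      using wm by (metis add.assoc of_nat_add of_nat_mult)
    moreover have "b + int (L (m mod n)) \<in> N"
      using L n by (auto simp: N_def)
    ultimately show ?thesis by blast
  qed
  then show thesis
    by (intro that[of N]) (auto simp: N_def)
qed

lemma exists_standard_basis:
  fixes G J :: "('r::finite \<Rightarrow> 'k::alg_closed_field fls) set" and x :: "'r \<Rightarrow> 'r \<Rightarrow> 'k fls"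
  assumes closed: "\<And>g h. g \<in> G \<Longrightarrow> h \<in> J \<Longrightarrow> g * h \<in> J"
    and prod: "\<And>k. is_product_of G (x k)"
    and pos: "\<And>k. x k k \<noteq> 0" "\<And>k. fls_subdegree (x k k) > 0"
    and supp: "\<And>k i. i \<noteq> k \<Longrightarrow> x k i = 0"
    and bound: "\<And>k f. f \<in> J \<Longrightarrow> f k \<noteq> 0 \<Longrightarrow> b k \<le> fls_subdegree (f k)"
  shows "\<exists>H. standard_basis_ideal G J H"
proof -
  define W where "W k = (\<lambda>f. fls_subdegree (f k)) ` {f \<in> J. f k \<noteq> 0}" for k
  have "\<exists>N. finite N \<and> N \<subseteq> W k \<and> (\<forall>w\<in>W k. \<exists>w0\<in>N. \<exists>m. w = w0 + int m * fls_subdegree (x k k))" for k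
  proof -
    have n: "nat (fls_subdegree (x k k)) > 0" "int (nat (fls_subdegree (x k k))) = fls_subdegree (x k k)"
      using pos(2)[of k] by auto
    have "b k \<le> w" if "w \<in> W k" for w
      using that bound by (auto simp: W_def)
    from finite_generators_mod_int[OF this n(1)] show ?thesis
      unfolding n(2) by metis
  qed
  then obtain N where N: "\<And>k. finite (N k)" "\<And>k. N k \<subseteq> W k"
      "\<And>k w. w \<in> W k \<Longrightarrow> \<exists>w0\<in>N k. \<exists>m. w = w0 + int m * fls_subdegree (x k k)"
    by metis
  \<comment> \<open>\<open>C k\<close> will be finitely many elements of \<open>J\<close> realising
    the values in \<open>N k\<close>.\<close>
  have "\<forall>k. \<exists>C. C \<subseteq> {f \<in> J. f k \<noteq> 0} \<and> finite C \<and> N k = (\<lambda>f. fls_subdegree (f k)) ` C"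
    using finite_subset_image[OF N(1) N(2)[unfolded W_def]] by blast
  from choice[OF this] obtain C where C: "\<And>k. C k \<subseteq> {f \<in> J. f k \<noteq> 0}" "\<And>k. finite (C k)"
      "\<And>k. N k = (\<lambda>f. fls_subdegree (f k)) ` C k"
    by auto
  \<comment> \<open>Each component of a value vector of \<open>E\<close> ranges over a finite set,
    with \<open>\<infinity>\<close> for branches on which the element vanishes; the finite set
    \<open>D\<close> will represent all these vectors.\<close>
  define E where "E = {f \<in> J - {0}. \<forall>k. val k f \<in> insert \<infinity> (Fin ` N k)}"
  have "(\<lambda>f k. val k f) ` E \<subseteq> (\<Pi>\<^sub>E k\<in>UNIV. insert \<infinity> (Fin ` N k))"
    by (auto simp: E_def PiE_iff)
  then have "finite ((\<lambda>f k. val k f) ` E)"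
    by (rule finite_subset) (auto intro!: finite_PiE simp: N(1))
  then obtain D where D: "D \<subseteq> E" "finite D" "(\<lambda>f k. val k f) ` E = (\<lambda>f k. val k f) ` D"
    using finite_subset_image by (metis order_refl)
  define H where "H = (\<Union>k. C k) \<union> D"
  have "admits_reduction H G f" if f: "f \<in> J - {0}" for f
  proof (cases "f \<in> E")
    case True
    \<comment> \<open>With equal value vectors the empty product suffices, and any branch on which
      \<open>f\<close> is nonzero serves.\<close>
    then obtain h where h: "h \<in> D" "(\<lambda>k. val k f) = (\<lambda>k. val k h)"
      using D(3) by blast
    obtain k where "f k \<noteq> 0"
      using f by (auto simp: fun_eq_iff)
    moreover have "val i (1 * h) = val i f" for i
      using h(2) by (metis mult_1)
    ultimately show ?thesis
      using h(1) by (intro admits_reductionI[OF _ _ is_product_of_one, of f k h]) (simp_all add: H_def)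
  next
    case False
    then obtain k where k: "val k f \<notin> insert \<infinity> (Fin ` N k)"
      using f by (auto simp: E_def)
    then have fk: "f k \<noteq> 0" "fls_subdegree (f k) \<notin> N k"
      by (auto simp: val_def split: if_splits)
    then have "fls_subdegree (f k) \<in> W k"
      using f by (auto simp: W_def)
    then obtain w0 m where w0: "w0 \<in> N k" "fls_subdegree (f k) = w0 + int m * fls_subdegree (x k k)"
      using N(3) by blast
    then obtain h where h: "h \<in> C k" "w0 = fls_subdegree (h k)"
      using C(3) by auto
    then have hk: "h k \<noteq> 0"
      using C(1)[of k] by auto
    \<comment> \<open>For \<open>m = 0\<close> the value would lie in \<open>N k\<close>. A positive
      exponent is what makes \<open>x k ^ m\<close> vanish off branch \<open>k\<close>, since
      \<open>x k ^ 0 = 1\<close>.\<close>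
    have "m \<noteq> 0"
      using w0 fk(2) by (intro notI) simp
    have eval: "(x k ^ m) i = x k i ^ m" for i
      by (induction m) simp_all
    have eq: "val k (x k ^ m * h) = val k f"
      using hk fk pos(1) w0 h(2) by (simp add: val_def eval fls_subdegree_pow)
    have "val i f \<le> val i (x k ^ m * h)" for i
    proof (cases "i = k")
      case False
      then show ?thesis
        using supp[OF False] \<open>m \<noteq> 0\<close> by (auto simp: val_le_iff eval)
    qed (simp add: eq)
    with eq show ?thesis
      using h(1) fk(1) by (intro admits_reductionI[OF _ _ is_product_of_power[OF prod], of f k h]) (auto simp: H_def)
  qed
  moreover have "finite H"
    using C(2) D(2) by (simp add: H_def)
  moreover have "H \<subseteq> J - {0}"
    using C(1) D(1) unfolding H_def E_def by fastforce
  ultimately show ?thesis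
    unfolding standard_basis_ideal_def by blast
qed

section \<open>The branches of a curve\<close>

lemma ring_of_type_algebra_simps:
  "carrier ring_of_type_algebra = UNIV"
  "x \<otimes>\<^bsub>ring_of_type_algebra\<^esub> y = x * y"
  "x \<oplus>\<^bsub>ring_of_type_algebra\<^esub> y = x + y"
  "\<zero>\<^bsub>ring_of_type_algebra\<^esub> = 0"
  "\<one>\<^bsub>ring_of_type_algebra\<^esub> = 1"
  by (auto simp: ring_of_type_algebra_def)

lemma carrier_curve_ring: "carrier (curve_ring Q) = range (\<lambda>g. Q +>\<^bsub>series_ring\<^esub> g)"
  by (auto simp: FactRing_def A_RCOSETS_def' ring_of_type_algebra_simps)

lemma coset_in_curve_ring: "Q +>\<^bsub>series_ring\<^esub> g \<in> carrier (curve_ring Q)"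
  by (simp add: carrier_curve_ring)

text \<open>\<open>P\<close> absorbs \<open>Q\<close>, so the image of a coset of \<open>Q\<close>
  in the branch ring can be computed from any representative.\<close>

lemma set_add_coset:
  assumes "ideal P series_ring" "ideal Q series_ring" "Q \<subseteq> P"
  shows "P <+>\<^bsub>series_ring\<^esub> (Q +>\<^bsub>series_ring\<^esub> g) = P +>\<^bsub>series_ring\<^esub> g"
proof -
  have "0 \<in> Q"
    using additive_subgroup.zero_closed[OF ideal.axioms(1)[OF assms(2)]]
    by (simp add: ring_of_type_algebra_simps)
  moreover have "p + q \<in> P" if "p \<in> P" "q \<in> Q" for p q
    using additive_subgroup.a_closed[OF ideal.axioms(1)[OF assms(1)], of p q] that assms(3)
    by (auto simp: ring_of_type_algebra_simps)
  ultimately show ?thesis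
    unfolding a_r_coset_def' set_add_def'
    by (force simp: ring_of_type_algebra_simps add.assoc[symmetric])
qed

lemma integral_over_mem:
  assumes "x \<in> S" "0 \<in> S" "1 \<in> S" "- x \<in> S"
  shows "integral_over S x"
  unfolding integral_over_def
  by (rule exI[of _ "[:- x, 1:]"]) (use assms in \<open>auto simp: coeff_pCons split: nat.splits\<close>)

section \<open>Parametrization of a single branch\<close>

locale branch =
  fixes P :: "('n::finite, 'k::alg_closed_field) mfps set" and \<phi> :: "('n, 'k) mfps set \<Rightarrow> 'k fls"
  assumes prime: "primeideal P series_ring" and norm: "branch_normalization P \<phi>"
begin

definition param :: "('n, 'k) mfps \<Rightarrow> 'k fls" where
  "param g = \<phi> (P +>\<^bsub>series_ring\<^esub> g)"

lemma is_ideal: "ideal P series_ring"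
  using prime by (rule primeideal.axioms)

lemma range_param: "range param = \<phi> ` carrier (curve_ring P)"
  by (auto simp: param_def carrier_curve_ring)

lemma hom: "\<phi> \<in> ring_hom (curve_ring P) ring_of_type_algebra"
  using norm by (simp add: branch_normalization_def)

lemma param_mult: "param (f * g) = param f * param g"
  using ring_hom_mult[OF hom coset_in_curve_ring[of P f] coset_in_curve_ring[of P g]]
    ideal.rcoset_mult_add[OF is_ideal, of f g]
  by (simp add: param_def FactRing_def ring_of_type_algebra_simps)

lemma param_add: "param (f + g) = param f + param g"
  using ring_hom_add[OF hom coset_in_curve_ring[of P f] coset_in_curve_ring[of P g]]
    ideal.a_rcos_sum[OF is_ideal, of f g]
  by (simp add: param_def FactRing_def ring_of_type_algebra_simps)

lemma param_one: "param 1 = 1"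
  using ring_hom_one[OF hom]
  by (simp add: param_def FactRing_def ring_of_type_algebra_simps)

lemma param_0: "param 0 = 0"
  using param_add[of 0 0] by (metis add.right_neutral add_left_imp_eq)

lemma param_minus: "param (- f) = - param f"
  using param_add[of f "- f"] by (simp add: param_0 eq_neg_iff_add_eq_0 add.commute)

lemma param_eq_0_iff: "param g = 0 \<longleftrightarrow> g \<in> P"
proof -
  have "param g = 0 \<longleftrightarrow> P +>\<^bsub>series_ring\<^esub> g = P +>\<^bsub>series_ring\<^esub> 0"
    using norm coset_in_curve_ring unfolding branch_normalization_def param_def
    by (metis (no_types, lifting) param_0 param_def inj_on_def)
  also have "P +>\<^bsub>series_ring\<^esub> 0 = P"
    by (simp add: a_r_coset_def' ring_of_type_algebra_simps)
  also have "P +>\<^bsub>series_ring\<^esub> g = P \<longleftrightarrow> g \<in> P"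
  proof
    show "P +>\<^bsub>series_ring\<^esub> g = P \<Longrightarrow> g \<in> P"
      using ideal.rcos_const_imp_mem[OF is_ideal, of g]
      by (simp add: ring_of_type_algebra_simps)
    interpret ideal P series_ring by (rule is_ideal)
    show "g \<in> P \<Longrightarrow> P +>\<^bsub>series_ring\<^esub> g = P"
      by (rule a_rcos_const)
  qed
  finally show ?thesis .
qed

text \<open>Elements of the branch ring are integral over it, hence their images lie in
  \<open>K[[t]]\<close>. The zero series is included because
  \<open>fls_subdegree 0 = 0\<close>.\<close>

lemma param_subdegree_nonneg: "fls_subdegree (param g) \<ge> 0"
proof -
  have "integral_over (range param) (param g)"
  proof (rule integral_over_mem)
    show "0 \<in> range param" by (metis param_0 rangeI)
    show "1 \<in> range param" by (metis param_one rangeI)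
    show "- param g \<in> range param" by (metis param_minus rangeI)
  qed simp
  then have "param g \<in> range fps_to_fls"
    using norm unfolding branch_normalization_def range_param by blast
  then show ?thesis
    using fls_subdegree_fls_to_fps_gt0 by auto
qed

text \<open>The uniformizer \<open>t\<close> is a fraction of elements of the branch ring, so its
  numerator has order one more than its denominator, whose order is nonnegative.\<close>

lemma exists_positive_subdegree: "\<exists>a. param a \<noteq> 0 \<and> fls_subdegree (param a) > 0"
proof -
  have "\<exists>a\<in>carrier (curve_ring P). \<exists>b\<in>carrier (curve_ring P). \<phi> b \<noteq> 0 \<and> fls_X = \<phi> a / \<phi> b"
    using norm unfolding branch_normalization_def by blast
  then obtain a b where "param b \<noteq> 0" "fls_X = param a / param b"
    by (auto simp: carrier_curve_ring param_def)
  then have b: "param b \<noteq> 0" and a: "param a = fls_X * param b"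
    by (metis nonzero_eq_divide_eq)+
  have "fls_subdegree (param a) = 1 + fls_subdegree (param b)" "param a \<noteq> 0"
    using b by (simp_all add: a)
  then show ?thesis
    using param_subdegree_nonneg[of b] by (intro exI[of _ a]) auto
qed

end

section \<open>Separating one branch from the others\<close>

lemma minimal_primes_prime: "P \<in> minimal_primes A J \<Longrightarrow> primeideal P A"
  by (simp add: minimal_primes_def)

text \<open>Distinct minimal primes are incomparable, so each \<open>P i\<close> with
  \<open>i \<noteq> k\<close> has an element outside \<open>P k\<close>. The product of these
  elements works, as \<open>P k\<close> is prime; with a single branch it is 1.\<close>

lemma exists_in_all_other_primes:
  fixes P :: "'r::finite \<Rightarrow> ('n::finite, 'k::comm_ring_1) mfps set"
  assumes inj: "inj P" and minimal: "range P \<subseteq> minimal_primes series_ring Q"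
  obtains g where "g \<notin> P k" "\<And>i. i \<noteq> k \<Longrightarrow> g \<in> P i"
proof -
  have prime: "primeideal (P i) series_ring" for i
    using minimal by (auto intro: minimal_primes_prime)
  have "\<exists>g. g \<in> P i \<and> g \<notin> P k" if "i \<noteq> k" for i
  proof -
    have "P i \<noteq> P k"
      using inj that by (auto dest: injD)
    moreover have "P i \<in> minimal_primes series_ring Q" "P k \<in> minimal_primes series_ring Q"
      using minimal by auto
    ultimately show ?thesis
      unfolding minimal_primes_def by auto
  qed
  then obtain g where g: "\<And>i. i \<noteq> k \<Longrightarrow> g i \<in> P i" "\<And>i. i \<noteq> k \<Longrightarrow> g i \<notin> P k"
    by metis
  have "(\<Prod>i\<in>F. g i) \<notin> P k" if "finite F" "k \<notin> F" for F
    using that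
  proof (induction F)
    case empty
    interpret primeideal "P k" series_ring by (rule prime)
    show ?case
      using I_notcarr one_imp_carrier by (auto simp: ring_of_type_algebra_simps)
  next
    case (insert i F)
    then show ?case
      using primeideal.I_prime[OF prime[of k], of "g i" "\<Prod>i\<in>F. g i"] g(2)[of i]
      by (auto simp: ring_of_type_algebra_simps)
  qed
  then have "(\<Prod>i\<in>- {k}. g i) \<notin> P k"
    by simp
  moreover have "(\<Prod>i\<in>- {k}. g i) \<in> P j" if "j \<noteq> k" for j
  proof -
    have "(\<Prod>i\<in>- {k}. g i) = g j * (\<Prod>i\<in>- {k} - {j}. g i)"
      using that by (intro prod.remove) auto
    then show ?thesis
      using ideal.I_r_closed[OF primeideal.axioms(1)[OF prime[of j]] g(1)[OF that]]
      by (simp add: ring_of_type_algebra_simps)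
  qed
  ultimately show thesis
    by (rule that)
qed

section \<open>Fractional ideals of a curve\<close>

theorem theorem7:
  fixes Q :: "('n::finite, 'k::alg_closed_field) mfps set"
    and M G :: "('n, 'k) mfps set set"
    and P :: "'r::finite \<Rightarrow> ('n, 'k) mfps set"
    and \<phi> :: "'r \<Rightarrow> ('n, 'k) mfps set \<Rightarrow> 'k fls"
    and I :: "('r \<Rightarrow> 'k fls) set"
  assumes "algebroid_curve Q M"
    and "branches Q P"
    and "\<And>i. branch_normalization (P i) (\<phi> i)"
    and "standard_basis_ring (curve_ring Q) M (to_total P \<phi>) G"
    and "fractional_ideal (curve_ring Q) (to_total P \<phi>) I"
  shows "\<exists>H. standard_basis_ideal (to_total P \<phi> ` G) I H"
proof -
  have P: "inj P" "range P = minimal_primes series_ring Q" "Q = (\<Inter>i. P i)"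
    using assms(2) unfolding branches_def by blast+
  have QP: "Q \<subseteq> P i" for i
    unfolding P(3) by blast
  have branch: "branch (P i) (\<phi> i)" for i
  proof (rule branch.intro)
    have "P i \<in> minimal_primes series_ring Q"
      by (subst P(2)[symmetric]) (rule rangeI)
    then show "primeideal (P i) series_ring"
      by (rule minimal_primes_prime)
  qed (rule assms(3))
  have idealQ: "ideal Q series_ring"
    using assms(1) by (simp add: algebroid_curve_def radical_ideal_def)
  have total: "to_total P \<phi> (Q +>\<^bsub>series_ring\<^esub> g) i = branch.param (P i) (\<phi> i) g" for g i
    by (simp add: to_total_def branch.param_def[OF branch]
        set_add_coset[OF branch.is_ideal[OF branch] idealQ QP])
  have total_nonneg: "fls_subdegree (to_total P \<phi> a i) \<ge> 0" if "a \<in> carrier (curve_ring Q)" for a i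
    using that branch.param_subdegree_nonneg[OF branch] by (auto simp: carrier_curve_ring total)

  have "\<exists>x. is_product_of (to_total P \<phi> ` G) x \<and> x k \<noteq> 0 \<and> fls_subdegree (x k) > 0 \<and>
      (\<forall>i. i \<noteq> k \<longrightarrow> x i = 0)" for k
  proof -
    obtain g where g: "g \<notin> P k" "\<And>i. i \<noteq> k \<Longrightarrow> g \<in> P i"
      using exists_in_all_other_primes[OF P(1) equalityD1[OF P(2)]] by blast
    obtain a where a: "branch.param (P k) (\<phi> k) a \<noteq> 0"
        "fls_subdegree (branch.param (P k) (\<phi> k) a) > 0"
      using branch.exists_positive_subdegree[OF branch] by blast
    \<comment> \<open>The factor \<open>g\<close> kills the other branches; the factor
      \<open>a\<close> forces positive order on branch \<open>k\<close>, where \<open>g\<close> is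
      only known to have nonnegative order.\<close>
    define f where "f = Q +>\<^bsub>series_ring\<^esub> (g * a)"
    have f_other: "to_total P \<phi> f i = 0" if "i \<noteq> k" for i
      using g(2)[OF that] branch.param_eq_0_iff[OF branch, of i g]
      by (simp add: f_def total branch.param_mult[OF branch])
    have gk: "branch.param (P k) (\<phi> k) g \<noteq> 0"
      using g(1) by (simp add: branch.param_eq_0_iff[OF branch])
    have fk: "to_total P \<phi> f k \<noteq> 0" "fls_subdegree (to_total P \<phi> f k) > 0"
      using gk a branch.param_subdegree_nonneg[OF branch, of k g]
      by (simp_all add: f_def total branch.param_mult[OF branch])
    have "f \<noteq> Q"
    proof
      assume "f = Q"
      then have "g * a \<in> Q"
        using ideal.rcos_const_imp_mem[OF idealQ, of "g * a"]
        by (simp add: f_def ring_of_type_algebra_simps)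
      then have "branch.param (P k) (\<phi> k) (g * a) = 0"
        using QP[of k] branch.param_eq_0_iff[OF branch] by blast
      then show False
        using fk by (simp add: f_def total)
    qed
    then have "f \<in> carrier (curve_ring Q) - {\<zero>\<^bsub>curve_ring Q\<^esub>}"
      by (simp add: f_def coset_in_curve_ring) (simp add: FactRing_def)
    then have "admits_reduction {1} (to_total P \<phi> ` G) (to_total P \<phi> f)"
      using assms(4) by (simp add: standard_basis_ring_def)
    then obtain k' c x where k': "to_total P \<phi> f k' \<noteq> 0"
      and x: "is_product_of (to_total P \<phi> ` G) x"
      and le: "\<And>i. val i (to_total P \<phi> f) \<le> val i (to_total P \<phi> f - (\<lambda>_. fls_const c) * x)"
      and less: "val k' (to_total P \<phi> f) < val k' (to_total P \<phi> f - (\<lambda>_. fls_const c) * x)"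
      unfolding admits_reduction_def k_reduction_def by (auto simp: val_eq_infinity_iff)
    \<comment> \<open>\<open>f\<close> is nonzero on branch \<open>k\<close> alone, so its reduction
      can only be a \<open>k\<close>-reduction.\<close>
    have [simp]: "k' = k"
      using k' f_other by blast
    have "c \<noteq> 0"
      using less by (auto simp: val_less_iff)
    \<comment> \<open>Off branch \<open>k\<close> the value of \<open>f\<close> is infinite and may
      not drop, so \<open>c\<close> times \<open>x\<close> vanishes there.\<close>
    moreover have "x i = 0" if "i \<noteq> k" for i
      using le[of i] f_other[OF that] \<open>c \<noteq> 0\<close> by (auto simp: val_le_iff)
    moreover have "x k \<noteq> 0"
      using less by (auto simp: val_less_iff)
    \<comment> \<open>If the orders differed, no cancellation would occur and the difference would
      have order at most that of \<open>f\<close>, against the strict increase.\<close>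
    moreover have "fls_subdegree (x k) = fls_subdegree (to_total P \<phi> f k)"
    proof (rule ccontr)
      assume neq: "fls_subdegree (x k) \<noteq> fls_subdegree (to_total P \<phi> f k)"
      have deg: "fls_subdegree (fls_const c * x k) = fls_subdegree (x k)"
        using \<open>c \<noteq> 0\<close> \<open>x k \<noteq> 0\<close> by simp
      show False
        using less fk(1) neq deg \<open>c \<noteq> 0\<close> \<open>x k \<noteq> 0\<close>
          fls_subdegree_diff_eq1[of "to_total P \<phi> f k" "fls_const c * x k"]
          fls_subdegree_diff_eq2[of "fls_const c * x k" "to_total P \<phi> f k"]
        by (cases "fls_subdegree (x k) < fls_subdegree (to_total P \<phi> f k)")
          (auto simp: val_less_iff)
    qed
    ultimately show ?thesis
      using x fk(2) by (intro exI[of _ x]) auto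
  qed
  then obtain x where x: "\<And>k. is_product_of (to_total P \<phi> ` G) (x k)" "\<And>k. x k k \<noteq> 0"
      "\<And>k. fls_subdegree (x k k) > 0" "\<And>k i. i \<noteq> k \<Longrightarrow> x k i = 0"
    by metis

  have closed: "g * h \<in> I" if "g \<in> to_total P \<phi> ` G" "h \<in> I" for g h
  proof -
    have "G \<subseteq> carrier (curve_ring Q)"
    proof -
      have "maximalideal M (curve_ring Q)"
        using assms(1) by (simp add: algebroid_curve_def local_ring_def)
      then have "M \<subseteq> carrier (curve_ring Q)"
        by (meson additive_subgroup.a_subset ideal.axioms(1) maximalideal.axioms(1))
      then show ?thesis
        using assms(4) by (auto simp: standard_basis_ring_def)
    qed
    moreover have "submodule I (curve_ring Q) (overring_module (to_total P \<phi>))"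
      using assms(5) by (simp add: fractional_ideal_def)
    ultimately show ?thesis
      using that submodule.smult_closed[of I "curve_ring Q" "overring_module (to_total P \<phi>)"]
      by (auto simp: overring_module_def)
  qed

  obtain S where S: "finite S" "I = {\<Sum>s\<in>S. to_total P \<phi> (a s) * s |a. a \<in> S \<rightarrow> carrier (curve_ring Q)}"
    using assms(5) unfolding fractional_ideal_def by blast
  \<comment> \<open>Coefficients from the curve ring have nonnegative order, so the orders of the
    generators bound those of all elements. The inserted 0 keeps the set nonempty and can only lower
    the bound.\<close>
  define b where "b k = Min (insert 0 ((\<lambda>s. fls_subdegree (s k)) ` S))" for k
  have bound: "b k \<le> fls_subdegree (f k)" if f: "f \<in> I" "f k \<noteq> 0" for f k
  proof (rule fls_subdegree_geI[OF f(2)])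
    fix n assume n: "n < b k"
    obtain a where a: "a \<in> S \<rightarrow> carrier (curve_ring Q)" "f = (\<Sum>s\<in>S. to_total P \<phi> (a s) * s)"
      using f(1) S(2) by blast
    \<comment> \<open>Arguing with coefficients below \<open>b k\<close> avoids the orders of
      partial sums, which may be zero.\<close>
    have "fls_nth ((\<Sum>s\<in>F. to_total P \<phi> (a s) * s) k) n = 0" if "finite F" "F \<subseteq> S" for F
      using that
    proof (induction F)
      case (insert s F)
      have "b k \<le> fls_subdegree (s k)"
        using insert.prems S(1) by (auto simp: b_def intro!: Min_le)
      moreover have "0 \<le> fls_subdegree (to_total P \<phi> (a s) k)"
        using a(1) insert.prems by (intro total_nonneg) auto
      ultimately have "fls_nth (to_total P \<phi> (a s) k * s k) n = 0"
        using n by (intro fls_times_nth_eq0) linarith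
      with insert show ?case by simp
    qed simp
    then show "fls_nth (f k) n = 0"
      using S(1) a(2) by blast
  qed

  show ?thesis
    by (rule exists_standard_basis[where G = "to_total P \<phi> ` G" and J = I and x = x and b = b])
      (fact closed x bound)+
qed

end
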